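(* For every $x,y\in\mathbb{N}$, $T(x,y)=1$ if and only if $E(x,y)$ has non-empty interior (as a subset of $\mathbb{R}$). Equivalently: (1) if $x,y\in V$ or $x,y\in D$, then $E(x,y)$ has empty interior; (2) if $x\in V$ and $y\in D$, or vice versa, then $E(x,y)$ has non-empty interior.
   Context: $\mathbb{N}$ denotes the positive integers. For $(x,y)\in\mathbb{N}^2$, $$E(x,y)=\left\{\sum_{n=1}^{\infty}\frac{\varepsilon_n}{4^n}:(\varepsilon_n)\in\{0,x,y,x+y\}^{\mathbb{N}}\right\}\subset\mathbb{R}.$$ $V$ is the set of positive integers whose last non-zero digit in base $4$ is $1$ or $3$, and $D=\mathbb{N}\setminus V$ is the set of those whose last non-zero base-$4$ digit is $2$. The function $c:\mathbb{N}\to\{0,1\}$ is $c(n)=1$ if $n\in V$ and $c(n)=0$ if $n\in D$. The parameter tiling $T:\mathbb{N}^2\to\{0,1\}$ is defined by $T(x,y)=1$ if $c(x)\neq c(y)$ and $T(x,y)=0$ if $c(x)=c(y)$. *)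

theory Defs
  imports "HOL-Analysis.Analysis"
begin

definition base4_digit :: "nat \<Rightarrow> nat \<Rightarrow> nat" where
  "base4_digit n k = (n div 4 ^ k) mod 4"

text \<open>The last (least significant) non-zero digit; meaningful only for \<^term>\<open>n > 0\<close>.\<close>

definition last_nonzero_digit :: "nat \<Rightarrow> nat" where
  "last_nonzero_digit n = base4_digit n (LEAST k. base4_digit n k \<noteq> 0)"

definition V :: "nat set" where
  "V = {n. n > 0 \<and> last_nonzero_digit n \<in> {1, 3}}"

definition D :: "nat set" where
  "D = {n. n > 0} - V"

definition c :: "nat \<Rightarrow> nat" where
  "c n = (if n \<in> V then 1 else 0)"

definition T :: "nat \<Rightarrow> nat \<Rightarrow> nat" where
  "T x y = (if c x \<noteq> c y then 1 else 0)"

text \<open>Sequences are indexed from 0 here, so the n-th entry carries the weight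
  \<^term>\<open>1 / 4 ^ Suc n\<close>. The series always converges, see \<open>summable_E\<close> below.\<close>

definition E :: "nat \<Rightarrow> nat \<Rightarrow> real set" where
  "E x y = {(\<Sum>n. real (\<epsilon> n) / 4 ^ Suc n) | \<epsilon> :: nat \<Rightarrow> nat. \<forall>n. \<epsilon> n \<in> {0, x, y, x + y}}"

lemma summable_E:
  fixes \<epsilon> :: "nat \<Rightarrow> nat"
  assumes "\<forall>n. \<epsilon> n \<in> {0, x, y, x + y}"
  shows "summable (\<lambda>n. real (\<epsilon> n) / 4 ^ Suc n)"
proof (rule summable_comparison_test')
  show "summable (\<lambda>n. real (x + y) * (1 / 4) ^ n)"
    by (intro summable_mult summable_geometric) simp
  fix n :: nat
  have "\<epsilon> n \<le> x + y" using assms[rule_format, of n] by auto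
  then have "real (\<epsilon> n) \<le> real (x + y)" by (rule of_nat_mono)
  then have "real (\<epsilon> n) / 4 ^ Suc n \<le> real (x + y) / 4 ^ n"
    by (intro frac_le) auto
  moreover have "real (x + y) / 4 ^ n = real (x + y) * (1 / 4) ^ n"
    by (simp only: power_one_over times_divide_eq_right mult_1_right)
  ultimately show "norm (real (\<epsilon> n) / 4 ^ Suc n) \<le> real (x + y) * (1 / 4) ^ n"
    by (simp only: real_norm_def abs_of_nonneg divide_nonneg_nonneg of_nat_0_le_iff zero_le_power zero_le_numeral)
qed

lemma last_nonzero_digit_nonzero:
  assumes "n > 0"
  shows "last_nonzero_digit n \<noteq> 0"
proof -
  have "\<exists>k. base4_digit n k \<noteq> 0"
    using assms
  proof (induction n rule: less_induct)
    case (less n)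
    show ?case
    proof (cases "n mod 4 = 0")
      case True
      then have "n div 4 > 0" "n div 4 < n" using less.prems by auto
      then obtain k where "base4_digit (n div 4) k \<noteq> 0" using less.IH by blast
      then have "base4_digit n (Suc k) \<noteq> 0"
        by (simp add: base4_digit_def div_mult2_eq)
      then show ?thesis by blast
    next
      case False
      then have "base4_digit n 0 \<noteq> 0" by (simp add: base4_digit_def)
      then show ?thesis by blast
    qed
  qed
  then show ?thesis unfolding last_nonzero_digit_def by (rule LeastI_ex)
qed

lemma D_eq: "D = {n. n > 0 \<and> last_nonzero_digit n = 2}"
proof -
  have lt: "last_nonzero_digit n < 4" for n
    by (simp add: last_nonzero_digit_def base4_digit_def)
  have "last_nonzero_digit n \<in> {1, 3} \<longleftrightarrow> last_nonzero_digit n \<noteq> 2" if "n > 0" for n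
    using lt[of n] last_nonzero_digit_nonzero[OF that] by auto
  then show ?thesis unfolding D_def V_def by blast
qed

end

theory Submission
  imports Defs
begin

text \<open>For \<^term>\<open>x > 0\<close>, membership in \<^term>\<open>V\<close> or \<^term>\<open>D\<close> is the parity of the exponent
of 2 in \<open>x\<close>: \<open>V\<close> consists of the numbers \<open>4^a p\<close> and \<open>D\<close> of the numbers \<open>4^a (2 p)\<close>
with \<open>p\<close> odd. So the claim is that \<open>E x y\<close> has interior exactly if these exponents of
\<open>x\<close> and \<open>y\<close> have different parities.

\<^bold>\<open>Different parities.\<close> \<open>E (4 x) y\<close> is the union of \<open>E x y\<close> and its translate by \<open>x\<close>, so
powers of 4 may be dropped, which leaves \<open>E p (2 q)\<close> with \<open>p\<close>, \<open>q\<close> odd. Its digits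
\<open>0, p, 2 q, p + 2 q\<close> represent each residue modulo 4 once
(\<open>complete_residues_mod_4\<close>). Hence every \<open>N / 4^n\<close> lies in an integer translate of
\<open>E p (2 q)\<close>, the integer translates of this compact set cover the real line, and by Baire's
theorem the set has interior (\<open>interior_E_odd_twice_odd\<close>).

\<^bold>\<open>Equal parities.\<close> Now \<open>x = u 4^a p\<close> and \<open>y = u 4^b q\<close> with \<open>p\<close>, \<open>q\<close> odd. If two digit
strings of length \<open>n\<close> give the same integer, then \<open>E x y\<close> is covered by fewer than \<open>4^n\<close>
copies of itself scaled by \<open>4^-n\<close>, so it is a null set
(\<open>interior_E_empty_if_collision\<close>). Collisions for \<open>(p, q)\<close> scale up to collisions for
\<open>(x, y)\<close>, so it remains to find one for odd \<open>p\<close>, \<open>q\<close>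
(\<open>digit_string_collision_odd\<close>). Without collisions, the \<open>4^n\<close> sums would form a subset of
\<open>{..< (p + q) 4^n}\<close>. Its character sums at the \<open>n\<close> frequencies \<open>4^-m\<close>, \<open>1 \<le> m \<le> n\<close>,
factor into products of cosines; none of these cosines vanishes, because \<open>p\<close> and \<open>q\<close> are odd,
and each character sum has absolute value at least \<open>4^n * 4 / (pi^2 p q)\<close>, by the telescoping
duplication formula for the sine. So \<open>n\<close> orthogonal characters all correlate with the set by
a fixed proportion of its size, which violates Bessel's inequality for large \<open>n\<close>. (In the
language of measures: the uniform digit measure on \<open>E p q\<close> has a non-zero Fourier coefficient
that is invariant under multiplication of the frequency by 4, so it does not obey the
Riemann-Lebesgue lemma and is not absolutely continuous.)\<close>

section \<open>Self-similarity\<close>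

abbreviation digit_set :: "nat \<Rightarrow> nat \<Rightarrow> nat set" where
  "digit_set x y \<equiv> {0, x, y, x + y}"

lemma E_commute: "E x y = E y x"
proof -
  have "digit_set x y = digit_set y x" by (auto simp: add.commute)
  then show ?thesis unfolding E_def by simp
qed

text \<open>Splitting off the first digit. Together with \<open>E_maximal\<close> below this characterises \<open>E x y\<close> as the
largest bounded set that is closed under removing a digit; all inclusions between such sets are
derived from these two facts without further manipulation of series.\<close>

lemma E_step:
  assumes "t \<in> E x y"
  shows "\<exists>d\<in>digit_set x y. 4 * t - real d \<in> E x y"
proof -
  obtain \<epsilon> where \<epsilon>: "\<forall>n. \<epsilon> n \<in> digit_set x y" and t: "t = (\<Sum>n. real (\<epsilon> n) / 4 ^ Suc n)"
    using assms unfolding E_def by blast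
  have sm: "summable (\<lambda>n. real (\<epsilon> (Suc n)) / 4 ^ Suc n)"
    using summable_E[of "\<lambda>n. \<epsilon> (Suc n)" x y] \<epsilon> by blast
  have "(\<Sum>n. real (\<epsilon> (Suc n)) / 4 ^ Suc n) / 4 = (\<Sum>n. real (\<epsilon> (Suc n)) / 4 ^ Suc (Suc n))"
    using suminf_divide[OF sm, of 4] by (simp add: field_simps)
  also have "\<dots> = t - real (\<epsilon> 0) / 4"
    using suminf_split_head[OF summable_E[OF \<epsilon>]] t by simp
  finally have "4 * t - real (\<epsilon> 0) = (\<Sum>n. real (\<epsilon> (Suc n)) / 4 ^ Suc n)" by simp
  moreover have "(\<Sum>n. real (\<epsilon> (Suc n)) / 4 ^ Suc n) \<in> E x y"
    unfolding E_def using \<epsilon> by (intro CollectI exI[of _ "\<lambda>n. \<epsilon> (Suc n)"]) auto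
  ultimately show ?thesis using \<epsilon> by metis
qed

text \<open>Coinduction: removing digits forever from a point of \<open>B\<close> produces a digit expansion, and the
remainder after \<open>n\<close> digits is a point of the bounded set \<open>B\<close> divided by \<open>4^n\<close>.\<close>

lemma E_maximal:
  assumes bd: "bounded B"
    and step: "\<And>t. t \<in> B \<Longrightarrow> \<exists>d\<in>digit_set x y. 4 * t - real d \<in> B"
  shows "B \<subseteq> E x y"
proof
  fix t assume tB: "t \<in> B"
  obtain d where d: "\<And>t. t \<in> B \<Longrightarrow> d t \<in> digit_set x y \<and> 4 * t - real (d t) \<in> B"
    using step by metis
  define u where "u n = ((\<lambda>t. 4 * t - real (d t)) ^^ n) t" for n
  have uB: "u n \<in> B" for n
    by (induction n) (use tB d in \<open>auto simp: u_def\<close>)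
  obtain M where M: "\<And>s. s \<in> B \<Longrightarrow> \<bar>s\<bar> \<le> M" using bd by (auto simp: bounded_iff)
  have part: "(\<Sum>k<n. real (d (u k)) / 4 ^ Suc k) = t - u n / 4 ^ n" for n
    by (induction n) (simp_all add: u_def field_simps)
  have "(\<lambda>n. M * (1 / 4) ^ n) \<longlonglongrightarrow> M * 0"
    by (intro tendsto_mult_left LIMSEQ_power_zero) simp
  then have lim: "(\<lambda>n. M * (1 / 4) ^ n) \<longlonglongrightarrow> 0" by simp
  have "(\<lambda>n. u n / 4 ^ n) \<longlonglongrightarrow> 0"
  proof (rule Lim_null_comparison[OF always_eventually lim], rule allI)
    fix n
    show "norm (u n / 4 ^ n) \<le> M * (1 / 4) ^ n"
      using M[OF uB[of n]] by (simp add: power_one_over divide_right_mono)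
  qed
  from tendsto_diff[OF tendsto_const[of t] this]
  have "(\<lambda>n. real (d (u n)) / 4 ^ Suc n) sums t"
    unfolding sums_def part by simp
  then show "t \<in> E x y"
    unfolding E_def using d[OF uB] sums_unique
    by (intro CollectI exI[of _ "\<lambda>n. d (u n)"]) blast
qed

lemma E_bounds:
  assumes "t \<in> E x y"
  shows "0 \<le> t" and "t \<le> real (x + y)"
proof -
  obtain \<epsilon> where \<epsilon>: "\<forall>n. \<epsilon> n \<in> digit_set x y" and t: "t = (\<Sum>n. real (\<epsilon> n) / 4 ^ Suc n)"
    using assms unfolding E_def by blast
  show "0 \<le> t" unfolding t by (intro suminf_nonneg summable_E[OF \<epsilon>]) simp
  have geo: "(\<lambda>n. real (x + y) / 4 * (1 / 4) ^ n) sums (real (x + y) / 4 * (1 / (1 - 1 / 4)))"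
    by (intro sums_mult geometric_sums) simp
  have "t \<le> (\<Sum>n. real (x + y) / 4 * (1 / 4) ^ n)"
    unfolding t
  proof (intro suminf_le summable_E[OF \<epsilon>] sums_summable[OF geo])
    fix n
    have "\<epsilon> n \<le> x + y" using \<epsilon>[rule_format, of n] by auto
    then have "real (\<epsilon> n) \<le> real (x + y)" by (rule of_nat_mono)
    then show "real (\<epsilon> n) / 4 ^ Suc n \<le> real (x + y) / 4 * (1 / 4) ^ n"
      by (simp add: power_one_over divide_simps)
  qed
  also have "\<dots> = real (x + y) / 3" using sums_unique[OF geo] by simp
  also have "\<dots> \<le> real (x + y)" by simp
  finally show "t \<le> real (x + y)" .
qed

lemma bounded_E: "bounded (E x y)"
proof -
  have "norm t \<le> real (x + y)" if "t \<in> E x y" for t using E_bounds[OF that] by simp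
  then show ?thesis unfolding bounded_iff by blast
qed

text \<open>The closure of \<open>E x y\<close> inherits the closure property in \<open>E_maximal\<close>, because there are only
finitely many digits.\<close>

lemma compact_E: "compact (E x y)"
proof -
  have "closure (E x y) \<subseteq> E x y"
  proof (rule E_maximal)
    show "bounded (closure (E x y))" by (rule bounded_closure[OF bounded_E])
    fix t assume t: "t \<in> closure (E x y)"
    let ?P = "\<lambda>d. (\<lambda>t. 4 * t - real d) -` closure (E x y)"
    have "closed (\<Union>d\<in>digit_set x y. ?P d)"
      by (intro closed_UN ballI closed_vimage closed_closure continuous_intros) auto
    moreover have "E x y \<subseteq> (\<Union>d\<in>digit_set x y. ?P d)"
      using E_step closure_subset by fastforce
    ultimately have "closure (E x y) \<subseteq> (\<Union>d\<in>digit_set x y. ?P d)"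
      by (intro closure_minimal)
    with t show "\<exists>d\<in>digit_set x y. 4 * t - real d \<in> closure (E x y)"
      unfolding UN_iff vimage_eq subset_iff by blast
  qed
  then have "closed (E x y)" by (simp add: closure_subset_eq)
  then show ?thesis using bounded_E by (simp add: compact_eq_bounded_closed)
qed

lemma zero_in_E: "0 \<in> E x y"
proof -
  have "{0} \<subseteq> E x y" by (rule E_maximal) auto
  then show ?thesis by simp
qed

lemma E_prepend:
  assumes "t \<in> E x y" "d \<in> digit_set x y"
  shows "(real d + t) / 4 \<in> E x y"
proof -
  have "insert ((real d + t) / 4) (E x y) \<subseteq> E x y"
  proof (rule E_maximal)
    fix s assume "s \<in> insert ((real d + t) / 4) (E x y)"
    then consider "s = (real d + t) / 4" | "s \<in> E x y" by blast
    then show "\<exists>d'\<in>digit_set x y. 4 * s - real d' \<in> insert ((real d + t) / 4) (E x y)"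
    proof cases
      case 1
      then have "4 * s - real d = t" by simp
      then show ?thesis using assms by (intro bexI[of _ d]) auto
    next
      case 2
      then show ?thesis using E_step by blast
    qed
  qed (use bounded_E in simp)
  then show ?thesis by blast
qed

text \<open>The set \<open>E (4 * x) y\<close> is \<open>E x y\<close> together with its translate by \<open>x\<close>: the expansion of the
\<open>x\<close>-part is read one place further to the left, and its leading digit becomes an offset 0 or \<open>x\<close>.
Only the inclusion from right to left is shown, by coinduction for the whole union.\<close>

lemma E_mono_times4: "E x y \<subseteq> E (4 * x) y"
proof -
  let ?B = "E x y \<union> (+) (real x) ` E x y"
  have "?B \<subseteq> E (4 * x) y"
  proof (rule E_maximal)
    show "bounded ?B" using bounded_E bounded_translation by auto
    fix t assume "t \<in> ?B"
    then obtain e c where e: "e \<in> E x y" and c: "c \<in> {0, x}" and t: "t = real c + e"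
      by force
    obtain d where d: "d \<in> digit_set x y" and ed: "4 * e - real d \<in> E x y"
      using E_step[OF e] by blast
    \<comment> \<open>Of the old digit, its multiple of \<open>y\<close> is kept and its multiple of \<open>x\<close> becomes the
        new offset.\<close>
    obtain i j where ij: "i \<in> {0, x}" "j \<in> {0, y}" "d = i + j" using d by force
    have eq: "4 * t - real (4 * c + j) = real i + (4 * e - real d)" using t ij by simp
    have shift: "real i + s \<in> ?B" if "s \<in> E x y" for s using ij(1) that by auto
    show "\<exists>d\<in>digit_set (4 * x) y. 4 * t - real d \<in> ?B"
    proof
      show "4 * t - real (4 * c + j) \<in> ?B" unfolding eq by (rule shift[OF ed])
      show "4 * c + j \<in> digit_set (4 * x) y" using c ij by auto
    qed
  qed
  then show ?thesis by blast
qed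

lemma E_mono_times_power4: "E x y \<subseteq> E (4 ^ a * x) (4 ^ b * y)"
proof -
  have *: "E x y \<subseteq> E (4 ^ a * x) y" for a x y
  proof (induction a)
    case (Suc a)
    have "E (4 ^ a * x) y \<subseteq> E (4 ^ Suc a * x) y"
      using E_mono_times4[of "4 ^ a * x" y] by (simp add: mult.assoc)
    then show ?case using Suc by blast
  qed simp
  have "E x y \<subseteq> E (4 ^ a * x) y" by (rule *)
  also have "\<dots> = E y (4 ^ a * x)" by (rule E_commute)
  also have "\<dots> \<subseteq> E (4 ^ b * y) (4 ^ a * x)" by (rule *)
  also have "\<dots> = E (4 ^ a * x) (4 ^ b * y)" by (rule E_commute)
  finally show ?thesis .
qed

section \<open>Non-empty interior from a complete residue system\<close>

lemma complete_residues_mod_4: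
  fixes p q :: nat
  assumes "odd p" "odd q"
  shows "\<exists>d\<in>digit_set p (2 * q). int d mod 4 = N mod 4"
proof -
  have "int p mod 4 = 1 \<or> int p mod 4 = 3" "int (2 * q) mod 4 = 2" using assms by presburger+
  then have "int 0 mod 4 = N mod 4 \<or> int p mod 4 = N mod 4 \<or> int (2 * q) mod 4 = N mod 4
      \<or> int (p + 2 * q) mod 4 = N mod 4"
    unfolding of_nat_add by presburger
  then show ?thesis by blast
qed

text \<open>Integer translates of \<open>E p (2 * q)\<close> are preserved by division by 4: in \<open>(e + m) / 4\<close> the
integer \<open>m\<close> is split into a digit, which is put in front of the expansion of \<open>e\<close>, and a multiple
of 4.\<close>

lemma quarter_power_in_E_plus_Ints:
  assumes "odd p" "odd q"
  shows "\<exists>e\<in>E p (2 * q). \<exists>m::int. of_int N / 4 ^ n = e + of_int m"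
proof (induction n arbitrary: N)
  case 0
  show ?case by (intro bexI[OF _ zero_in_E] exI[of _ N]) simp
next
  case (Suc n)
  obtain e m where e: "e \<in> E p (2 * q)" and N: "of_int N / 4 ^ n = e + of_int m"
    using Suc by blast
  obtain d where d: "d \<in> digit_set p (2 * q)" "int d mod 4 = m mod 4"
    using complete_residues_mod_4[OF assms] by blast
  then obtain k where k: "m = int d + 4 * k"
    by (metis mod_eqE)
  have "of_int N / 4 ^ Suc n = (e + of_int m) / 4" using N by (simp add: field_simps)
  also have "\<dots> = (real d + e) / 4 + of_int k" using k by simp
  finally show ?case using E_prepend[OF e d(1)] by blast
qed

text \<open>The integer translates of the set are dense by the previous lemma, and their union is closed as
the sum of a compact and a closed set. So countably many translates cover the line.\<close>

lemma interior_E_odd_twice_odd: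
  assumes "odd p" "odd q"
  shows "interior (E p (2 * q)) \<noteq> {}"
proof
  let ?E = "E p (2 * q)"
  assume empty: "interior ?E = {}"
  let ?S = "\<Union>e\<in>?E. \<Union>m\<in>\<int>. {e + m}"
  have "closed ?S" by (intro compact_closed_sums compact_E closed_Ints)
  then have "closure ?S = ?S" by (rule closure_closed)
  moreover have "t \<in> closure ?S" for t :: real
  proof -
    have "(\<lambda>n. of_int \<lfloor>4 ^ n * t\<rfloor> / 4 ^ n) \<longlonglongrightarrow> t"
    proof (rule LIM_zero_cancel, rule Lim_null_comparison)
      show "\<forall>\<^sub>F n in sequentially. norm (of_int \<lfloor>4 ^ n * t\<rfloor> / 4 ^ n - t) \<le> (1 / 4) ^ n"
      proof (rule always_eventually, rule allI)
        fix n :: nat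
        have "\<bar>of_int \<lfloor>4 ^ n * t\<rfloor> - 4 ^ n * t\<bar> \<le> 1" by linarith
        moreover have "of_int \<lfloor>4 ^ n * t\<rfloor> / 4 ^ n - t = (of_int \<lfloor>4 ^ n * t\<rfloor> - 4 ^ n * t) / 4 ^ n"
          by (simp add: field_simps)
        ultimately show "norm (of_int \<lfloor>4 ^ n * t\<rfloor> / 4 ^ n - t) \<le> (1 / 4) ^ n"
          by (simp add: power_one_over divide_right_mono)
      qed
    qed (intro LIMSEQ_power_zero, simp)
    moreover have "of_int \<lfloor>4 ^ n * t\<rfloor> / 4 ^ n \<in> ?S" for n
    proof -
      obtain e m where "e \<in> ?E" "of_int \<lfloor>4 ^ n * t\<rfloor> / 4 ^ n = e + of_int m"
        using quarter_power_in_E_plus_Ints[OF assms] by blast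
      then show ?thesis by (intro UN_I[of e] UN_I[of "of_int m"]) simp_all
    qed
    ultimately show ?thesis
      unfolding closure_sequential by (intro exI[of _ "\<lambda>n. of_int \<lfloor>4 ^ n * t\<rfloor> / 4 ^ n"]) simp
  qed
  ultimately have cover: "t \<in> ?S" for t by (simp only:)
  have "t \<in> (\<Union>m::int. (+) (of_int m) ` ?E)" for t
  proof -
    obtain e and m :: int where "e \<in> ?E" "t = e + of_int m"
      using cover[of t] by (auto simp: Ints_def)
    then have "t \<in> (+) (of_int m) ` ?E" by (simp add: image_iff add.commute)
    then show ?thesis by blast
  qed
  then have "(\<Union>m::int. (+) (of_int m) ` ?E) = UNIV" by blast
  moreover have "euclidean interior_of (\<Union>(range (\<lambda>m::int. (+) (real_of_int m) ` ?E))) = {}"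
  proof (rule Baire_category_alt)
    fix T assume "T \<in> range (\<lambda>m::int. (+) (real_of_int m) ` ?E)"
    then obtain m :: int where T: "T = (+) (of_int m) ` ?E" by blast
    have "closed T" unfolding T by (intro closed_translation compact_imp_closed compact_E)
    moreover have "interior T = {}" unfolding T interior_translation empty by simp
    ultimately show "closedin euclidean T \<and> euclidean interior_of T = {}" by simp
  qed (simp_all add: completely_metrizable_space_euclidean)
  ultimately show False by simp
qed

section \<open>Bessel's inequality and products of cosines\<close>

text \<open>Bessel's inequality for the indicator function of \<open>S\<close> and functions that are orthogonal on \<open>X\<close>
with squared norm \<open>W\<close>. With the coefficients \<open>a j\<close>, the function \<open>g\<close> in the proof sums over \<open>S\<close>
to the left-hand side \<open>B\<close>, and its squared norm on \<open>X\<close> is \<open>W * B\<close>; the Cauchy-Schwarz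
inequality compares the two.\<close>

lemma Bessel_inequality:
  fixes f :: "'j \<Rightarrow> 'a \<Rightarrow> complex"
  assumes fin: "finite X" "finite J" and S: "S \<subseteq> X"
    and orth: "\<And>j l. j \<in> J \<Longrightarrow> l \<in> J \<Longrightarrow>
      (\<Sum>s\<in>X. f j s * cnj (f l s)) = (if j = l then of_real W else 0)"
    and W: "W \<ge> 0"
  shows "(\<Sum>j\<in>J. (cmod (\<Sum>s\<in>S. f j s))\<^sup>2) \<le> W * card S"
proof -
  define a where "a j = (\<Sum>s\<in>S. f j s)" for j
  define B where "B = (\<Sum>j\<in>J. (cmod (a j))\<^sup>2)"
  define g where "g s = (\<Sum>j\<in>J. cnj (a j) * f j s)" for s
  have "(\<Sum>s\<in>S. g s) = (\<Sum>j\<in>J. cnj (a j) * (\<Sum>s\<in>S. f j s))"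
    unfolding g_def by (subst sum.swap) (simp add: sum_distrib_left)
  also have "\<dots> = of_real B"
    unfolding B_def a_def[symmetric] by (simp add: complex_norm_square mult.commute del: of_real_power)
  finally have sum_g: "(\<Sum>s\<in>S. g s) = of_real B" .
  have "of_real (\<Sum>s\<in>X. (cmod (g s))\<^sup>2) = (\<Sum>s\<in>X. g s * cnj (g s))"
    by (simp add: complex_norm_square[symmetric])
  also have "\<dots> = (\<Sum>s\<in>X. \<Sum>j\<in>J. \<Sum>l\<in>J. cnj (a j) * a l * (f j s * cnj (f l s)))"
    unfolding g_def cnj_sum sum_product by (simp add: mult_ac)
  also have "\<dots> = (\<Sum>j\<in>J. \<Sum>s\<in>X. \<Sum>l\<in>J. cnj (a j) * a l * (f j s * cnj (f l s)))"
    by (rule sum.swap)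
  also have "\<dots> = (\<Sum>j\<in>J. \<Sum>l\<in>J. \<Sum>s\<in>X. cnj (a j) * a l * (f j s * cnj (f l s)))"
    by (intro sum.cong refl sum.swap)
  also have "\<dots> = (\<Sum>j\<in>J. \<Sum>l\<in>J. cnj (a j) * a l * (if j = l then of_real W else 0))"
    by (intro sum.cong refl) (simp add: sum_distrib_left[symmetric] orth)
  also have "\<dots> = (\<Sum>j\<in>J. of_real W * of_real ((cmod (a j))\<^sup>2))"
    using fin(2) by (intro sum.cong refl) (simp add: complex_norm_square mult_ac if_distrib sum.delta
        del: of_real_power cong: if_cong)
  also have "\<dots> = of_real (W * B)"
    unfolding B_def by (simp add: sum_distrib_left)
  finally have sum_g2: "(\<Sum>s\<in>X. (cmod (g s))\<^sup>2) = W * B" by (metis of_real_eq_iff)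
  have B0: "B \<ge> 0" unfolding B_def by (intro sum_nonneg) simp
  have "B = cmod (\<Sum>s\<in>S. g s)" using sum_g B0 by simp
  also have "\<dots> \<le> (\<Sum>s\<in>S. 1 * cmod (g s))" using norm_sum[of g S] by simp
  finally have "B\<^sup>2 \<le> (\<Sum>s\<in>S. 1 * cmod (g s))\<^sup>2" using B0 by (intro power_mono)
  also have "\<dots> \<le> (\<Sum>s\<in>S. 1\<^sup>2) * (\<Sum>s\<in>S. (cmod (g s))\<^sup>2)" by (rule Cauchy_Schwarz_ineq_sum)
  also have "\<dots> \<le> (\<Sum>s\<in>S. 1\<^sup>2) * (\<Sum>s\<in>X. (cmod (g s))\<^sup>2)"
    using S fin(1) by (intro mult_left_mono sum_mono2 sum_nonneg) auto
  finally have "B * B \<le> (W * card S) * B" unfolding sum_g2 by (simp add: power2_eq_square mult_ac)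
  then have "B \<le> W * card S" using B0 W by (cases "B = 0") auto
  then show ?thesis unfolding B_def a_def .
qed

text \<open>A number whose base-4 digits are all 0 or 1, encoded by the set of positions of the digits 1. A
sum over all such numbers is then a sum over a power set, which expands a product.\<close>

definition quaternary :: "nat set \<Rightarrow> nat" where
  "quaternary A = (\<Sum>k\<in>A. 4 ^ k)"

lemma quaternary_insert: "finite A \<Longrightarrow> k \<notin> A \<Longrightarrow> quaternary (insert k A) = 4 ^ k + quaternary A"
  by (simp add: quaternary_def)

lemma quaternary_less:
  assumes "A \<subseteq> {..<n}"
  shows "quaternary A < 4 ^ n"
proof -
  have "quaternary A \<le> (\<Sum>k<n. 4 ^ k)"
    unfolding quaternary_def using assms by (intro sum_mono2) auto
  also have "\<dots> < 4 ^ n" by (induction n) auto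
  finally show ?thesis .
qed

lemma quaternary_shift: "quaternary ((+) b ` A) = 4 ^ b * quaternary A"
  unfolding quaternary_def by (subst sum.reindex) (auto simp: power_add sum_distrib_left)

lemma sum_cis_quaternary:
  fixes \<theta> :: real
  shows "(\<Sum>A\<in>Pow {..<n}. cis (\<theta> * quaternary A)) = (\<Prod>k<n. 1 + cis (\<theta> * 4 ^ k))"
proof -
  have "cis (\<theta> * quaternary A) = (\<Prod>k\<in>A. cis (\<theta> * 4 ^ k))" if "A \<subseteq> {..<n}" for A
  proof -
    have "finite A" using that finite_subset by blast
    then show ?thesis
      by induction (simp_all add: quaternary_def ring_distribs cis_mult[symmetric] del: cis_mult)
  qed
  then show ?thesis
    using prod_add[of "{..<n}" "\<lambda>k. cis (\<theta> * 4 ^ k)" "\<lambda>_. 1"] by (simp add: add.commute)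
qed

lemma norm_one_plus_cis:
  fixes \<phi> :: real
  shows "cmod (1 + cis \<phi>) = 2 * \<bar>cos (\<phi> / 2)\<bar>"
proof -
  have "1 + cis \<phi> = cis (\<phi> / 2) * (cis (- \<phi> / 2) + cis (\<phi> / 2))"
    by (simp add: distrib_left cis_mult)
  also have "cis (- \<phi> / 2) + cis (\<phi> / 2) = of_real (2 * cos (\<phi> / 2))"
    by (simp add: complex_eq_iff)
  finally show ?thesis by (simp add: norm_mult)
qed

text \<open>Telescoping of \<open>sin \<phi> = 4 sin (\<phi>/4) cos (\<phi>/4) cos (\<phi>/2)\<close>. Each step discards the factor
\<open>cos (\<phi>/4)\<close>, so that only cosines at angles in the ratio 4 remain.\<close>

lemma abs_sin_le_prod_cos:
  fixes \<phi> :: real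
  shows "\<bar>sin \<phi>\<bar> \<le> 4 ^ m * \<bar>sin (\<phi> / 4 ^ m)\<bar> * (\<Prod>i<m. \<bar>cos (2 * \<phi> / 4 ^ Suc i)\<bar>)"
proof (induction m)
  case (Suc m)
  let ?\<psi> = "\<phi> / 4 ^ Suc m"
  have "sin (\<phi> / 4 ^ m) = sin (2 * (2 * ?\<psi>))" by simp
  also have "\<dots> = 4 * sin ?\<psi> * cos ?\<psi> * cos (2 * ?\<psi>)"
    by (simp only: sin_double mult_ac)
  finally have "\<bar>sin (\<phi> / 4 ^ m)\<bar> = 4 * \<bar>sin ?\<psi>\<bar> * \<bar>cos ?\<psi>\<bar> * \<bar>cos (2 * ?\<psi>)\<bar>"
    by (simp add: abs_mult)
  also have "\<dots> \<le> 4 * \<bar>sin ?\<psi>\<bar> * 1 * \<bar>cos (2 * ?\<psi>)\<bar>"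
    by (intro mult_mono) auto
  finally have "4 ^ m * \<bar>sin (\<phi> / 4 ^ m)\<bar> * (\<Prod>i<m. \<bar>cos (2 * \<phi> / 4 ^ Suc i)\<bar>)
      \<le> 4 ^ m * (4 * \<bar>sin ?\<psi>\<bar> * 1 * \<bar>cos (2 * ?\<psi>)\<bar>) * (\<Prod>i<m. \<bar>cos (2 * \<phi> / 4 ^ Suc i)\<bar>)"
    by (intro mult_right_mono mult_left_mono prod_nonneg) auto
  from order_trans[OF Suc this] show ?case by (simp add: mult_ac)
qed simp

text \<open>The bound is uniform in \<open>m\<close>. Telescoping starts at the angle \<open>\<phi> = pi * p / 2\<close>, where the sine
is 1 or -1 because \<open>p\<close> is odd, and ends at a small angle, where the sine is at most the angle.\<close>

lemma prod_abs_cos_lower_bound: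
  assumes "odd p"
  shows "2 / (pi * real p) \<le> (\<Prod>i<m. \<bar>cos (pi * real p / 4 ^ Suc i)\<bar>)"
proof -
  let ?P = "\<Prod>i<m. \<bar>cos (pi * real p / 4 ^ Suc i)\<bar>"
  have p: "p > 0" using assms odd_pos by blast
  have "\<bar>sin (pi * real p / 2)\<bar> = 1"
  proof -
    have "cos (pi * real p / 2) = 0"
      unfolding cos_zero_iff using assms by (intro disjI1 exI[of _ p]) auto
    then show ?thesis using sin_cos_squared_add[of "pi * real p / 2"]
      by (auto simp add: power2_eq_1_iff)
  qed
  then have "1 \<le> 4 ^ m * \<bar>sin (pi * real p / 2 / 4 ^ m)\<bar> * ?P"
    using abs_sin_le_prod_cos[of "pi * real p / 2" m] by simp
  also have "\<dots> \<le> 4 ^ m * \<bar>pi * real p / 2 / 4 ^ m\<bar> * ?P"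
    by (intro mult_right_mono mult_left_mono abs_sin_x_le_abs_x prod_nonneg) auto
  also have "\<dots> = pi * real p / 2 * ?P" by simp
  finally show ?thesis using p by (simp add: field_simps)
qed

text \<open>The sum factors into \<open>2 cos (pi * p * 4^k / 4^m)\<close> for \<open>k < n\<close>. For \<open>k \<ge> m\<close> the angle is a
multiple of \<open>pi\<close> and the cosine has absolute value 1; the other positions give the product of
the previous lemma in reverse order.\<close>

lemma norm_sum_cis_quaternary_ge:
  assumes "odd p" "m \<le> n"
  shows "2 ^ n * (2 / (pi * real p)) \<le> cmod (\<Sum>A\<in>Pow {..<n}. cis (2 * pi / 4 ^ m * real p * quaternary A))"
proof -
  let ?h = "\<lambda>k. \<bar>cos (pi * real p * 4 ^ k / 4 ^ m)\<bar>"
  have "cmod (\<Sum>A\<in>Pow {..<n}. cis (2 * pi / 4 ^ m * real p * quaternary A)) = (\<Prod>k<n. 2 * ?h k)"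
    unfolding sum_cis_quaternary prod_norm[symmetric] norm_one_plus_cis
    by (simp add: mult_ac)
  also have "\<dots> = 2 ^ n * (\<Prod>k<n. ?h k)" by (simp add: prod.distrib)
  also have "(\<Prod>k<n. ?h k) = (\<Prod>k<m. ?h k)"
  proof (rule prod.mono_neutral_right)
    show "\<forall>k\<in>{..<n} - {..<m}. ?h k = 1"
    proof
      fix k assume "k \<in> {..<n} - {..<m}"
      then have "(4::real) ^ k = 4 ^ (k - m) * 4 ^ m" by (simp flip: power_add)
      then have "pi * real p * 4 ^ k / 4 ^ m = real (p * 4 ^ (k - m)) * pi"
        by (simp add: mult_ac)
      then show "?h k = 1" by (simp only: cos_npi) simp
    qed
  qed (use assms in auto)
  also have "\<dots> = (\<Prod>i<m. \<bar>cos (pi * real p / 4 ^ Suc i)\<bar>)"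
  proof (rule prod.reindex_bij_witness[of _ "\<lambda>i. m - Suc i" "\<lambda>i. m - Suc i"])
    fix k assume "k \<in> {..<m}"
    then have "(4::real) ^ m = 4 ^ k * 4 ^ Suc (m - Suc k)"
      by (simp flip: power_add power_Suc)
    then show "\<bar>cos (pi * real p / 4 ^ Suc (m - Suc k))\<bar> = ?h k" by simp
  qed auto
  finally have "cmod (\<Sum>A\<in>Pow {..<n}. cis (2 * pi / 4 ^ m * real p * quaternary A))
      = 2 ^ n * (\<Prod>i<m. \<bar>cos (pi * real p / 4 ^ Suc i)\<bar>)" .
  also have "\<dots> \<ge> 2 ^ n * (2 / (pi * real p))"
    by (intro mult_left_mono prod_abs_cos_lower_bound assms) simp
  finally show ?thesis .
qed

text \<open>Both frequencies are multiples of \<open>4^-n\<close> and differ by less than 1, so for different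
frequencies a geometric sum runs over \<open>r\<close> full periods.\<close>

lemma cis_power4_orthogonal:
  assumes "m \<le> n" "l \<le> n"
  shows "(\<Sum>s<r * 4 ^ n. cis (2 * pi / 4 ^ m * real s) * cnj (cis (2 * pi / 4 ^ l * real s)))
    = (if m = l then of_real (r * 4 ^ n) else 0)"
proof -
  let ?\<theta> = "1 / 4 ^ m - 1 / 4 ^ l :: real"
  define z where "z = cis (2 * pi * ?\<theta>)"
  have eq: "cis (2 * pi / 4 ^ m * real s) * cnj (cis (2 * pi / 4 ^ l * real s)) = z ^ s" for s
    unfolding z_def cis_cnj cis_mult Complex.DeMoivre
    by (rule arg_cong[of _ _ cis]) (simp add: algebra_simps)
  show ?thesis
  proof (cases "m = l")
    case True
    then show ?thesis unfolding eq z_def by simp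
  next
    case False
    have "\<bar>?\<theta>\<bar> < 1" "?\<theta> \<noteq> 0"
    proof -
      have "0 < 1 / (4::real) ^ k \<and> 1 / (4::real) ^ k \<le> 1" for k by simp
      from this[of m] this[of l] show "\<bar>?\<theta>\<bar> < 1" by linarith
      show "?\<theta> \<noteq> 0" using False by simp
    qed
    have "z \<noteq> 1"
    proof
      assume "z = 1"
      then have "cos (2 * pi * ?\<theta>) = 1" unfolding z_def by (simp add: complex_eq_iff)
      then obtain k :: int where "2 * pi * ?\<theta> = of_int k * 2 * pi" using cos_one_2pi_int by blast
      then have "?\<theta> = of_int k" by simp
      then show False using \<open>\<bar>?\<theta>\<bar> < 1\<close> \<open>?\<theta> \<noteq> 0\<close> by simp
    qed
    moreover have "z ^ (r * 4 ^ n) = 1"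
    proof -
      have "(4::real) ^ n / 4 ^ m = 4 ^ (n - m)" "(4::real) ^ n / 4 ^ l = 4 ^ (n - l)"
        using assms by (simp_all add: power_diff)
      moreover have "real (r * 4 ^ n) * ?\<theta> = real r * (4 ^ n / 4 ^ m - 4 ^ n / 4 ^ l)"
        by (simp add: right_diff_distrib)
      ultimately have "real (r * 4 ^ n) * ?\<theta> = of_int (int r * (4 ^ (n - m) - 4 ^ (n - l)))"
        by simp
      then have "real (r * 4 ^ n) * (2 * pi * ?\<theta>) = 2 * pi * of_int (int r * (4 ^ (n - m) - 4 ^ (n - l)))"
        by (metis mult.left_commute)
      then show ?thesis unfolding z_def Complex.DeMoivre by (simp only: cis_multiple_2pi Ints_of_int)
    qed
    ultimately show ?thesis
      using False unfolding eq by (simp add: sum_gp_strict)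
  qed
qed

section \<open>Collisions of digit strings\<close>

text \<open>The integer with base-4 digits from \<open>{0, x, y, x + y}\<close>, where \<open>A\<close> holds the positions whose
digit contains \<open>x\<close>, and \<open>B\<close> those whose digit contains \<open>y\<close>.\<close>

definition digit_string_value :: "nat \<Rightarrow> nat \<Rightarrow> nat set \<times> nat set \<Rightarrow> nat" where
  "digit_string_value x y = (\<lambda>(A, B). x * quaternary A + y * quaternary B)"

text \<open>If there were no collision, then for every \<open>n\<close> the \<open>4^n\<close> sums would be distinct numbers below
\<open>(p + q) * 4^n\<close>, and their character sums would factor as double sums over \<open>A\<close> and \<open>B\<close>. Bessel's
inequality for the frequencies \<open>4^-m\<close> with \<open>1 \<le> m \<le> n\<close> then gives \<open>n * K^2 \<le> p + q\<close> with a
constant \<open>K > 0\<close>, which fails for large \<open>n\<close>.\<close>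

lemma digit_string_collision_odd:
  assumes p: "odd p" and q: "odd q"
  shows "\<exists>n. \<not> inj_on (digit_string_value p q) (Pow {..<n} \<times> Pow {..<n})"
proof (rule ccontr)
  assume "\<nexists>n. \<not> inj_on (digit_string_value p q) (Pow {..<n} \<times> Pow {..<n})"
  then have inj: "inj_on (digit_string_value p q) (Pow {..<n} \<times> Pow {..<n})" for n by blast
  define K where "K = 2 / (pi * real p) * (2 / (pi * real q))"
  have "p > 0" "q > 0" using p q odd_pos by auto
  then have K: "K > 0" unfolding K_def by simp
  have main: "real n * K\<^sup>2 \<le> real (p + q)" for n
  proof -
    let ?P = "Pow {..<n}"
    define S where "S = digit_string_value p q ` (?P \<times> ?P)"
    define X where "X = {..<(p + q) * 4 ^ n}"
    have card: "real (card S) = 4 ^ n"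
      unfolding S_def using card_image[OF inj[of n]]
      by (simp add: card_cartesian_product card_Pow flip: power_mult_distrib)
    have SX: "S \<subseteq> X"
    proof
      fix s assume "s \<in> S"
      then obtain A B where AB: "A \<subseteq> {..<n}" "B \<subseteq> {..<n}"
        and s: "s = p * quaternary A + q * quaternary B"
        unfolding S_def digit_string_value_def by auto
      have "s < p * 4 ^ n + q * 4 ^ n"
        unfolding s using \<open>p > 0\<close> \<open>q > 0\<close> quaternary_less[OF AB(1)] quaternary_less[OF AB(2)]
        by (intro add_strict_mono) auto
      then show "s \<in> X" unfolding X_def by (simp add: ring_distribs)
    qed
    have large: "4 ^ n * K \<le> cmod (\<Sum>s\<in>S. cis (2 * pi / 4 ^ m * real s))" if "m \<in> {1..n}" for m
    proof -
      let ?\<theta> = "2 * pi / 4 ^ m"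
      have "(\<Sum>s\<in>S. cis (?\<theta> * real s))
          = (\<Sum>(A, B)\<in>?P \<times> ?P. cis (?\<theta> * p * quaternary A) * cis (?\<theta> * q * quaternary B))"
        unfolding S_def
        by (subst sum.reindex[OF inj])
          (simp add: digit_string_value_def case_prod_beta cis_mult ring_distribs add_divide_distrib mult.assoc)
      also have "\<dots> = (\<Sum>A\<in>?P. cis (?\<theta> * p * quaternary A)) * (\<Sum>B\<in>?P. cis (?\<theta> * q * quaternary B))"
        by (simp add: sum_product sum.cartesian_product)
      finally have "cmod (\<Sum>s\<in>S. cis (?\<theta> * real s))
          = cmod (\<Sum>A\<in>?P. cis (?\<theta> * p * quaternary A)) * cmod (\<Sum>B\<in>?P. cis (?\<theta> * q * quaternary B))"
        by (simp add: norm_mult)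
      also have "\<dots> \<ge> (2 ^ n * (2 / (pi * real p))) * (2 ^ n * (2 / (pi * real q)))"
        using that p q by (intro mult_mono norm_sum_cis_quaternary_ge) auto
      also have "(2 ^ n * (2 / (pi * real p))) * (2 ^ n * (2 / (pi * real q))) = 4 ^ n * K"
        by (simp add: K_def flip: power_mult_distrib)
      finally show ?thesis .
    qed
    have "real n * (4 ^ n * K)\<^sup>2 = (\<Sum>m\<in>{1..n}. (4 ^ n * K)\<^sup>2)" by simp
    also have "\<dots> \<le> (\<Sum>m\<in>{1..n}. (cmod (\<Sum>s\<in>S. cis (2 * pi / 4 ^ m * real s)))\<^sup>2)"
      using large K by (intro sum_mono power_mono) auto
    also have "\<dots> \<le> real ((p + q) * 4 ^ n) * real (card S)"
    proof (rule Bessel_inequality[OF _ _ SX])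
      fix m l assume "m \<in> {1..n}" "l \<in> {1..n}"
      then show "(\<Sum>s\<in>X. cis (2 * pi / 4 ^ m * real s) * cnj (cis (2 * pi / 4 ^ l * real s)))
          = (if m = l then of_real (real ((p + q) * 4 ^ n)) else 0)"
        unfolding X_def by (subst cis_power4_orthogonal[of m n l]) auto
    qed (auto simp: X_def)
    finally have "(real n * K\<^sup>2) * (4 ^ n)\<^sup>2 \<le> real (p + q) * (4 ^ n)\<^sup>2"
      by (simp add: card power2_eq_square mult_ac)
    then show ?thesis by simp
  qed
  obtain n where "real (p + q) < real n * K\<^sup>2"
    using ex_less_of_nat_mult[of "K\<^sup>2" "real (p + q)"] K by auto
  then show False using main[of n] by linarith
qed

section \<open>Collisions force empty interior\<close>

lemma E_expansion:
  assumes "t \<in> E x y"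
  shows "\<exists>A\<subseteq>{..<n}. \<exists>B\<subseteq>{..<n}. 4 ^ n * t - real (digit_string_value x y (A, B)) \<in> E x y"
  using assms
proof (induction n arbitrary: t)
  case 0
  then show ?case by (simp add: digit_string_value_def quaternary_def)
next
  case (Suc n)
  obtain d where d: "d \<in> digit_set x y" and td: "4 * t - real d \<in> E x y"
    using E_step[OF Suc.prems] by blast
  obtain A B where AB: "A \<subseteq> {..<n}" "B \<subseteq> {..<n}"
    and e: "4 ^ n * (4 * t - real d) - real (digit_string_value x y (A, B)) \<in> E x y"
    using Suc.IH[OF td] by blast
  have fin: "finite A" "finite B" "n \<notin> A" "n \<notin> B" using AB finite_subset by auto
  obtain A' B' where AB': "A' \<subseteq> {..<Suc n}" "B' \<subseteq> {..<Suc n}"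
    and eq: "digit_string_value x y (A', B') = 4 ^ n * d + digit_string_value x y (A, B)"
  proof -
    consider "d = 0" | "d = x" | "d = y" | "d = x + y" using d by blast
    then show thesis
    proof cases
      case 1
      then show ?thesis using AB by (intro that[of A B]) auto
    next
      case 2
      then show ?thesis using AB fin
        by (intro that[of "insert n A" B]) (auto simp: digit_string_value_def quaternary_insert ring_distribs)
    next
      case 3
      then show ?thesis using AB fin
        by (intro that[of A "insert n B"]) (auto simp: digit_string_value_def quaternary_insert ring_distribs)
    next
      case 4
      then show ?thesis using AB fin
        by (intro that[of "insert n A" "insert n B"])
          (auto simp: digit_string_value_def quaternary_insert ring_distribs)
    qed
  qed
  have "4 ^ Suc n * t - real (digit_string_value x y (A', B'))
      = 4 ^ n * (4 * t - real d) - real (digit_string_value x y (A, B))"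
    unfolding eq by (simp add: algebra_simps)
  with e have "4 ^ Suc n * t - real (digit_string_value x y (A', B')) \<in> E x y" by (simp only:)
  then show ?case using AB' by blast
qed

text \<open>\<open>E x y\<close> is the union of the sets \<open>(s + E x y) / 4^n\<close>, one for each value \<open>s\<close> of a digit string
of length \<open>n\<close>. A collision leaves fewer than \<open>4^n\<close> values, and then subadditivity of Lebesgue
measure forces the measure of \<open>E x y\<close> to be 0.\<close>

lemma interior_E_empty_if_collision:
  assumes "\<not> inj_on (digit_string_value x y) (Pow {..<n} \<times> Pow {..<n})"
  shows "interior (E x y) = {}"
proof -
  let ?P = "Pow {..<n} \<times> Pow {..<n}"
  define S where "S = digit_string_value x y ` ?P"
  define F where "F s = (\<lambda>e. (1 / 4 ^ n) *\<^sub>R e + real s / 4 ^ n) ` E x y" for s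
  have cardP: "card ?P = 4 ^ n"
    by (simp add: card_cartesian_product card_Pow flip: power_mult_distrib)
  have "card S < 4 ^ n"
    using card_image_le[of ?P "digit_string_value x y"] eq_card_imp_inj_on[of ?P "digit_string_value x y"] assms
    unfolding S_def cardP by fastforce
  have lm: "E x y \<in> lmeasurable" by (intro lmeasurable_compact compact_E)
  have Fm: "F s \<in> lmeasurable" for s
    unfolding F_def by (intro lmeasurable_compact compact_continuous_image compact_E continuous_intros)
  have "E x y \<subseteq> (\<Union>s\<in>S. F s)"
  proof
    fix t assume t: "t \<in> E x y"
    obtain A B where AB: "A \<subseteq> {..<n}" "B \<subseteq> {..<n}"
      and e: "4 ^ n * t - real (digit_string_value x y (A, B)) \<in> E x y"
      using E_expansion[OF t, of n] by blast
    have "t \<in> F (digit_string_value x y (A, B))"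
      unfolding F_def by (rule image_eqI[OF _ e]) (simp add: diff_divide_distrib)
    then show "t \<in> (\<Union>s\<in>S. F s)" using AB unfolding S_def by blast
  qed
  moreover have "(\<Union>s\<in>S. F s) \<in> lmeasurable"
    using Fm by (intro fmeasurable.finite_UN) (simp_all add: S_def)
  ultimately have "measure lebesgue (E x y) \<le> measure lebesgue (\<Union>s\<in>S. F s)"
    by (rule measure_mono_fmeasurable[OF _ fmeasurableD[OF lm]])
  also have "\<dots> \<le> (\<Sum>s\<in>S. measure lebesgue (F s))"
    by (intro measure_UNION_le fmeasurableD Fm) (simp add: S_def)
  also have "\<dots> = real (card S) * (measure lebesgue (E x y) / 4 ^ n)"
    unfolding F_def measure_lebesgue_affine by simp
  finally have "measure lebesgue (E x y) \<le> real (card S) * measure lebesgue (E x y) / 4 ^ n"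
    by (simp only: times_divide_eq_right)
  then have "measure lebesgue (E x y) * 4 ^ n \<le> real (card S) * measure lebesgue (E x y)"
    by (subst (asm) pos_le_divide_eq) simp_all
  then have "(4 ^ n - real (card S)) * measure lebesgue (E x y) \<le> 0"
    unfolding left_diff_distrib mult.commute[of _ "4 ^ n"] by simp
  moreover have "4 ^ n - real (card S) > 0"
    using \<open>card S < 4 ^ n\<close> of_nat_less_iff[of "card S" "4 ^ n", where ?'a = real] by simp
  ultimately have "measure lebesgue (E x y) = 0"
    using measure_nonneg[of lebesgue "E x y"] by (simp add: mult_le_0_iff)
  then have "negligible (E x y)" using lm by (simp add: negligible_iff_measure)
  then have "negligible (interior (E x y))" by (rule negligible_subset[OF _ interior_subset])
  then show ?thesis using open_not_negligible open_interior by blast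
qed

lemma digit_string_value_shift:
  "digit_string_value (u * 4 ^ a * p) (u * 4 ^ b * q) ((+) b ` A, (+) a ` B)
    = u * 4 ^ (a + b) * digit_string_value p q (A, B)"
  by (simp add: digit_string_value_def quaternary_shift power_add ring_distribs)

text \<open>The shifts by \<open>b\<close> and \<open>a\<close> give both terms the common factor \<open>u * 4^(a + b)\<close>, so a collision for
\<open>(p, q)\<close> becomes one for the scaled pair.\<close>

lemma interior_E_common_odd_scale:
  assumes "odd p" "odd q"
  shows "interior (E (u * 4 ^ a * p) (u * 4 ^ b * q)) = {}"
proof -
  let ?x = "u * 4 ^ a * p" and ?y = "u * 4 ^ b * q"
  obtain n where "\<not> inj_on (digit_string_value p q) (Pow {..<n} \<times> Pow {..<n})"
    using digit_string_collision_odd[OF assms] by blast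
  then obtain A B A' B' where
    sub: "A \<subseteq> {..<n}" "B \<subseteq> {..<n}" "A' \<subseteq> {..<n}" "B' \<subseteq> {..<n}"
    and ne: "(A, B) \<noteq> (A', B')"
    and eq: "digit_string_value p q (A, B) = digit_string_value p q (A', B')"
    unfolding inj_on_def by (auto simp: Ball_def)
  let ?n = "n + a + b"
  have eq': "digit_string_value ?x ?y ((+) b ` A, (+) a ` B) = digit_string_value ?x ?y ((+) b ` A', (+) a ` B')"
    unfolding digit_string_value_shift eq ..
  have ne': "((+) b ` A, (+) a ` B) \<noteq> ((+) b ` A', (+) a ` B')"
    using ne by (simp add: inj_image_eq_iff)
  have shift: "(+) k ` C \<in> Pow {..<?n}" if "C \<subseteq> {..<n}" "k \<le> a + b" for k C
  proof -
    have "k + i < ?n" if "i \<in> C" for i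
    proof -
      have "i < n" using \<open>C \<subseteq> {..<n}\<close> that by blast
      then show ?thesis using \<open>k \<le> a + b\<close> by linarith
    qed
    then show ?thesis by auto
  qed
  have "\<not> inj_on (digit_string_value ?x ?y) (Pow {..<?n} \<times> Pow {..<?n})"
  proof
    assume "inj_on (digit_string_value ?x ?y) (Pow {..<?n} \<times> Pow {..<?n})"
    from inj_onD[OF this eq'] ne' show False
      using sub by (simp add: shift del: Pow_iff)
  qed
  then show ?thesis by (rule interior_E_empty_if_collision)
qed

section \<open>The sets V and D and powers of 2\<close>

lemma last_nonzero_digit_4_power_mult:
  assumes "u mod 4 \<noteq> 0"
  shows "last_nonzero_digit (4 ^ a * u) = u mod 4"
proof -
  have at: "base4_digit (4 ^ a * u) a = u mod 4" by (simp add: base4_digit_def)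
  have "(LEAST k. base4_digit (4 ^ a * u) k \<noteq> 0) = a"
  proof (rule Least_equality)
    show "base4_digit (4 ^ a * u) a \<noteq> 0" using assms at by simp
    fix k assume nz: "base4_digit (4 ^ a * u) k \<noteq> 0"
    show "a \<le> k"
    proof (rule ccontr)
      assume "\<not> a \<le> k"
      then obtain i where "a = k + Suc i" by (metis less_imp_Suc_add not_le add_Suc_right)
      then have eq: "4 ^ a * u = 4 ^ k * (4 * (4 ^ i * u))" by (simp add: power_add)
      from nz show False unfolding base4_digit_def eq by simp
    qed
  qed
  then show ?thesis unfolding last_nonzero_digit_def using at by simp
qed

lemma power4_decomposition:
  fixes n :: nat
  assumes "n > 0"
  obtains a u where "n = 4 ^ a * u" "u mod 4 \<noteq> 0"
proof -
  have "\<not> is_unit (4 :: nat)" by simp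
  then obtain u where "n = 4 ^ multiplicity 4 n * u" "\<not> 4 dvd u"
    using assms multiplicity_decompose'[of n 4] by (metis not_gr_zero)
  then show thesis using that by (simp add: mod_eq_0_iff_dvd)
qed

lemma V_obtain:
  assumes "n \<in> V"
  obtains a p where "n = 4 ^ a * p" "odd p"
proof -
  have "n > 0" using assms unfolding V_def by simp
  then obtain a u where n: "n = 4 ^ a * u" "u mod 4 \<noteq> 0" by (rule power4_decomposition)
  then have "u mod 4 \<in> {1, 3}" using assms last_nonzero_digit_4_power_mult unfolding V_def by simp
  then have "u mod 4 = 1 \<or> u mod 4 = 3" by simp
  then have "odd u" by presburger
  then show thesis using that n by blast
qed

lemma D_obtain:
  assumes "n \<in> D"
  obtains a p where "n = 4 ^ a * (2 * p)" "odd p"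
proof -
  have "n > 0" using assms unfolding D_def by simp
  then obtain a u where n: "n = 4 ^ a * u" "u mod 4 \<noteq> 0" by (rule power4_decomposition)
  then have "u mod 4 = 2" using assms last_nonzero_digit_4_power_mult unfolding D_eq by simp
  then have "u = 2 * (u div 2)" "odd (u div 2)" by presburger+
  then show thesis using that n by metis
qed

lemma interior_E_V_D:
  assumes "x \<in> V" "y \<in> D"
  shows "interior (E x y) \<noteq> {}"
proof -
  obtain a p where x: "x = 4 ^ a * p" "odd p" using V_obtain[OF assms(1)] .
  obtain b q where y: "y = 4 ^ b * (2 * q)" "odd q" using D_obtain[OF assms(2)] .
  show ?thesis
    using interior_E_odd_twice_odd[OF x(2) y(2)] interior_mono[OF E_mono_times_power4[of p "2 * q" a b]]
    unfolding x(1) y(1) by blast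
qed

lemma interior_E_V_V:
  assumes "x \<in> V" "y \<in> V"
  shows "interior (E x y) = {}"
proof -
  obtain a p where x: "x = 4 ^ a * p" "odd p" using V_obtain[OF assms(1)] .
  obtain b q where y: "y = 4 ^ b * q" "odd q" using V_obtain[OF assms(2)] .
  show ?thesis using interior_E_common_odd_scale[OF x(2) y(2), of 1 a b] unfolding x(1) y(1) by simp
qed

lemma interior_E_D_D:
  assumes "x \<in> D" "y \<in> D"
  shows "interior (E x y) = {}"
proof -
  obtain a p where x: "x = 4 ^ a * (2 * p)" "odd p" using D_obtain[OF assms(1)] .
  obtain b q where y: "y = 4 ^ b * (2 * q)" "odd q" using D_obtain[OF assms(2)] .
  have "x = 2 * 4 ^ a * p" "y = 2 * 4 ^ b * q" unfolding x(1) y(1) by simp_all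
  then show ?thesis using interior_E_common_odd_scale[OF x(2) y(2)] by blast
qed

theorem theorem1p2:
  fixes x y :: nat
  assumes "x > 0" and "y > 0"
  shows "(T x y = 1 \<longleftrightarrow> interior (E x y) \<noteq> {})
    \<and> ((x \<in> V \<and> y \<in> V) \<or> (x \<in> D \<and> y \<in> D) \<longrightarrow> interior (E x y) = {})
    \<and> ((x \<in> V \<and> y \<in> D) \<or> (x \<in> D \<and> y \<in> V) \<longrightarrow> interior (E x y) \<noteq> {})"
proof -
  have D: "z \<in> D \<longleftrightarrow> z \<notin> V" if "z > 0" for z using that unfolding D_def by auto
  have same: "(x \<in> V \<and> y \<in> V) \<or> (x \<in> D \<and> y \<in> D) \<Longrightarrow> interior (E x y) = {}"
    using interior_E_V_V interior_E_D_D by blast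
  have different: "(x \<in> V \<and> y \<in> D) \<or> (x \<in> D \<and> y \<in> V) \<Longrightarrow> interior (E x y) \<noteq> {}"
    using interior_E_V_D[of x y] interior_E_V_D[of y x] unfolding E_commute[of y x] by blast
  have "T x y = 1 \<longleftrightarrow> (x \<in> V \<and> y \<in> D) \<or> (x \<in> D \<and> y \<in> V)"
    using D[OF assms(1)] D[OF assms(2)] by (auto simp: T_def c_def)
  then show ?thesis
    using same different D[OF assms(1)] D[OF assms(2)] by blast
qed

end
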